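(* Let $\Phi_1$ and $\Phi_2$ be $N$-functions. Then $T^1_{\Phi_1,\Phi_2}(\mathbb{R})\neq0$.
   Context: An $N$-function is a function $\Phi:\mathbb{R}\to[0,\infty)$ that is even and convex, with $\Phi(x)=0\iff x=0$, $\lim_{x\to0}\Phi(x)/x=0$ and $\lim_{x\to\infty}\Phi(x)/x=\infty$. For a Riemannian manifold $X$ of dimension $n$ (here $X=\mathbb{R}$ with the standard metric, $n=1$) with volume element $d\mu_X$, and a measurable $k$-form $\omega$ with pointwise norm $|\omega(x)|$, put $\rho_\Phi(\omega)=\int_X\Phi(|\omega(x)|)\,d\mu_X$. Forms differing on a set of measure zero are identified. $L^\Phi(X,\Lambda^k)$ is the space of measurable $k$-forms $\omega$ with $\rho_\Phi(\alpha\omega)<\infty$ for some $\alpha>0$, endowed with the gauge norm $\|\omega\|_{(\Phi)}=\inf\{K>0:\rho_\Phi(\omega/K)\le1\}$; it is a Banach space. Weak differential: a locally integrable $(j+1)$-form $\theta$ is the (weak) differential $d\omega$ of a locally integrable $j$-form $\omega$ if $\int_U\omega\wedge du=(-1)^{j+1}\int_U\theta\wedge u$ for every orientable domain $U\subset\mathrm{Int}\,X$ and every smooth compactly supported $(n-j-1)$-form $u$ with support in $U$. $B^k_{\Phi_1,\Phi_2}(X)=\{\omega\in L^{\Phi_2}(X,\Lambda^k):\omega=d\beta\text{ for some }\beta\in L^{\Phi_1}(X,\Lambda^{k-1})\}$; $\overline B^k_{\Phi_1,\Phi_2}(X)$ is its closure in $L^{\Phi_2}(X,\Lambda^k)$.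 The torsion is $T^k_{\Phi_1,\Phi_2}(X)=\overline B^k_{\Phi_1,\Phi_2}(X)/B^k_{\Phi_1,\Phi_2}(X)$. *)

theory Defs
  imports "HOL-Analysis.Analysis"
begin

definition N_function :: "(real \<Rightarrow> real) \<Rightarrow> bool" where
  "N_function \<Phi> \<longleftrightarrow>
     (\<forall>x. 0 \<le> \<Phi> x) \<and>
     (\<forall>x. \<Phi> (- x) = \<Phi> x) \<and>
     convex_on UNIV \<Phi> \<and>
     (\<forall>x. \<Phi> x = 0 \<longleftrightarrow> x = 0) \<and>
     ((\<lambda>x. \<Phi> x / x) \<longlongrightarrow> 0) (at 0) \<and>
     filterlim (\<lambda>x. \<Phi> x / x) at_top at_top"

text \<open>
  Differential forms on the real line: a 0-form is a function, and a 1-form assigns to each point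
  a covector, i.e. a linear functional on the tangent space \<open>\<real>\<close>, with the dual (operator) norm.
  Forms are represented by functions, not by classes modulo null sets; all the spaces defined
  below are saturated under almost-everywhere equality.
\<close>

type_synonym form0 = "real \<Rightarrow> real"
type_synonym form1 = "real \<Rightarrow> (real \<Rightarrow>\<^sub>L real)"

definition modular :: "(real \<Rightarrow> real) \<Rightarrow> (real \<Rightarrow> 'a::real_normed_vector) \<Rightarrow> ennreal" where
  "modular \<Phi> \<omega> = (\<integral>\<^sup>+x. ennreal (\<Phi> (norm (\<omega> x))) \<partial>lebesgue)"

definition orlicz_space :: "(real \<Rightarrow> real) \<Rightarrow> (real \<Rightarrow> 'a::real_normed_vector) set" where
  "orlicz_space \<Phi> =
     {\<omega> \<in> borel_measurable lebesgue. \<exists>\<alpha>>0. modular \<Phi> (\<lambda>x. \<alpha> *\<^sub>R \<omega> x) < \<infinity>}"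

definition gauge_norm :: "(real \<Rightarrow> real) \<Rightarrow> (real \<Rightarrow> 'a::real_normed_vector) \<Rightarrow> real" where
  "gauge_norm \<Phi> \<omega> = Inf {K. K > 0 \<and> modular \<Phi> (\<lambda>x. \<omega> x /\<^sub>R K) \<le> 1}"

definition locally_integrable :: "(real \<Rightarrow> 'a::real_normed_vector) \<Rightarrow> bool" where
  "locally_integrable \<omega> \<longleftrightarrow>
     \<omega> \<in> borel_measurable lebesgue \<and>
     (\<forall>C. compact C \<longrightarrow> (\<integral>\<^sup>+x\<in>C. ennreal (norm (\<omega> x)) \<partial>lebesgue) < \<infinity>)"

definition smooth_function :: "form0 \<Rightarrow> bool" where
  "smooth_function u \<longleftrightarrow> (\<forall>k. (deriv ^^ k) u differentiable_on UNIV)"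

definition support :: "form0 \<Rightarrow> real set" where
  "support u = closure {x. u x \<noteq> 0}"

definition differential :: "form0 \<Rightarrow> form1" where
  "differential u = (\<lambda>x. Blinfun (frechet_derivative u (at x)))"

definition form_integral :: "real set \<Rightarrow> form1 \<Rightarrow> real" where
  "form_integral U \<theta> = (LINT x:U|lebesgue. blinfun_apply (\<theta> x) 1)"

text \<open>
  The case \<open>n = 1\<close>, \<open>j = 0\<close>: test forms have degree \<open>n - j - 1 = 0\<close>, and the wedge product of a
  0-form and a 1-form, in either order, is pointwise scalar multiplication.  Every domain in
  \<open>\<real>\<close> is orientable; reversing the orientation changes the sign of both sides.
\<close>

definition weak_differential :: "form0 \<Rightarrow> form1 \<Rightarrow> bool" where
  "weak_differential \<omega> \<theta> \<longleftrightarrow>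
     locally_integrable \<omega> \<and> locally_integrable \<theta> \<and>
     (\<forall>U u. open U \<and> connected U \<and> smooth_function u \<and> compact (support u) \<and> support u \<subseteq> U \<longrightarrow>
        form_integral U (\<lambda>x. \<omega> x *\<^sub>R differential u x) =
        - form_integral U (\<lambda>x. u x *\<^sub>R \<theta> x))"

definition exact_forms :: "(real \<Rightarrow> real) \<Rightarrow> (real \<Rightarrow> real) \<Rightarrow> form1 set" where
  "exact_forms \<Phi>1 \<Phi>2 =
     {\<omega> \<in> orlicz_space \<Phi>2. \<exists>\<beta> \<in> orlicz_space \<Phi>1. weak_differential \<beta> \<omega>}"

definition closure_exact_forms :: "(real \<Rightarrow> real) \<Rightarrow> (real \<Rightarrow> real) \<Rightarrow> form1 set" where
  "closure_exact_forms \<Phi>1 \<Phi>2 =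
     {\<omega> \<in> orlicz_space \<Phi>2.
        \<forall>\<epsilon>>0. \<exists>\<eta> \<in> exact_forms \<Phi>1 \<Phi>2. gauge_norm \<Phi>2 (\<lambda>x. \<omega> x - \<eta> x) < \<epsilon>}"

text \<open>
  The underlying set of the quotient vector space; its zero element is the coset
  \<open>exact_forms \<Phi>1 \<Phi>2\<close>.  Since that coset contains all forms vanishing almost everywhere,
  this quotient also performs the identification of almost everywhere equal forms.
\<close>

definition torsion :: "(real \<Rightarrow> real) \<Rightarrow> (real \<Rightarrow> real) \<Rightarrow> form1 set set" where
  "torsion \<Phi>1 \<Phi>2 = closure_exact_forms \<Phi>1 \<Phi>2 //
     {(\<omega>, \<omega>'). \<omega> \<in> closure_exact_forms \<Phi>1 \<Phi>2 \<and> \<omega>' \<in> closure_exact_forms \<Phi>1 \<Phi>2 \<and>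
        (\<lambda>x. \<omega> x - \<omega>' x) \<in> exact_forms \<Phi>1 \<Phi>2}"

end

theory Submission
  imports Defs "HOL-Computational_Algebra.Polynomial"
begin

text \<open>
  The nonzero torsion class is that of \<open>\<omega> = 1\<^bsub>[0,1]\<^esub> dx\<close>.  Its primitives are equal to two
  different constants near \<open>-\<infinity>\<close> and near \<open>+\<infinity>\<close>, so none of them should be in \<open>L\<^sup>\<Phi>\<close>; but the
  jump from one constant to the other can be undone at arbitrarily small cost, by descending
  linearly over a long interval.

  Precisely, let \<open>\<eta>\<^sub>L\<close> be the differential of the compactly supported tent that rises to 1 on
  \<open>[0,1]\<close> and descends to 0 on \<open>[1,1+L]\<close> (\<open>tent_slope_exact\<close>).  Then \<open>\<omega> - \<eta>\<^sub>L\<close> has norm \<open>1/L\<close> on an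
  interval of length \<open>L\<close> and vanishes elsewhere, so that \<open>\<rho>((\<omega> - \<eta>\<^sub>L)/K) = L \<Phi>2(1/(LK))\<close>, and this
  tends to 0 as \<open>L \<rightarrow> \<infinity>\<close> because \<open>\<Phi>2(y)/y \<rightarrow> 0\<close> as \<open>y \<rightarrow> 0\<close>.  Hence \<open>\<omega>\<close> lies in the closure of the
  exact forms (\<open>unit_form_in_closure\<close>).

  Suppose that \<open>\<omega> = d\<beta>\<close> with \<open>\<beta>\<close> in \<open>L\<^bsup>\<Phi>1\<^esup>\<close>, and test this against smooth bumps \<open>u\<^sub>R\<close> obtained by
  dilating one fixed bump by the factor \<open>R\<close>.  The integral of \<open>u\<^sub>R\<close> over \<open>[0,1]\<close> stays away from 0.
  It is also equal to minus the integral of \<open>\<beta> u\<^sub>R'\<close>, which is at most a constant times the mean of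
  \<open>|\<beta>|\<close> over \<open>[-R,R]\<close> since \<open>|u\<^sub>R'| \<le> 4/R\<close> (\<open>abs_deriv_cutoff_le\<close>).  These means tend to 0
  (\<open>orlicz_space_mean_tendsto_zero\<close>), a contradiction (\<open>unit_form_not_exact\<close>).
\<close>

section \<open>N-functions and Orlicz spaces\<close>

lemma N_function_scale:
  assumes "N_function \<Phi>" "0 \<le> t" "t \<le> 1"
  shows "\<Phi> (t * x) \<le> t * \<Phi> x"
proof -
  have "convex_on UNIV \<Phi>" "\<Phi> 0 = 0"
    using assms(1) by (auto simp: N_function_def)
  then show ?thesis
    using convex_onD[of UNIV \<Phi> t 0 x] assms by simp
qed

lemma N_function_mono:
  assumes "N_function \<Phi>" "0 \<le> s" "s \<le> t"
  shows "\<Phi> s \<le> \<Phi> t"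
proof (cases "t = 0")
  case False
  have "\<Phi> s \<le> s / t * \<Phi> t"
    using N_function_scale[of \<Phi> "s / t" t] assms False by simp
  also have "\<dots> \<le> 1 * \<Phi> t"
    using assms False by (intro mult_right_mono) (auto simp: N_function_def)
  finally show ?thesis by simp
qed (use assms in auto)

lemma N_function_pos:
  assumes "N_function \<Phi>" "x \<noteq> 0"
  shows "0 < \<Phi> x"
  using assms by (metis N_function_def order_le_less)

text \<open>
  By convexity and \<open>\<Phi> 0 = 0\<close> the quotient \<open>\<Phi> s / s\<close> is nondecreasing, so beyond \<open>\<epsilon>\<close> the graph of \<open>\<Phi>\<close>
  lies above its chord from 0 to \<open>\<epsilon>\<close>.  This bounds a function by its modular up to an
  arbitrarily small constant.
\<close>

lemma N_function_dominates_linear: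
  assumes "N_function \<Phi>" "0 < \<epsilon>" "0 \<le> s"
  shows "s \<le> \<epsilon> + \<epsilon> / \<Phi> \<epsilon> * \<Phi> s"
proof (cases "s \<le> \<epsilon>")
  case True
  then show ?thesis
    using N_function_pos[of \<Phi> \<epsilon>] N_function_pos[of \<Phi> s] assms
    by (cases "s = 0") (auto simp: N_function_def intro!: add_increasing2)
next
  case False
  have "\<Phi> \<epsilon> \<le> \<epsilon> / s * \<Phi> s"
    using N_function_scale[of \<Phi> "\<epsilon> / s" s] assms False by simp
  then have "s \<le> \<epsilon> / \<Phi> \<epsilon> * \<Phi> s"
    using N_function_pos[of \<Phi> \<epsilon>] assms False by (simp add: field_simps)
  then show ?thesis using assms by simp
qed

lemma N_function_borel_measurable:
  assumes "N_function \<Phi>"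
  shows "\<Phi> \<in> borel_measurable borel"
  using assms convex_on_continuous[of UNIV \<Phi>]
  by (auto simp: N_function_def intro: borel_measurable_continuous_onI)

lemma orlicz_space_bounded_support:
  fixes \<omega> :: "real \<Rightarrow> 'a::real_normed_vector"
  assumes \<Phi>: "N_function \<Phi>" and meas: "\<omega> \<in> borel_measurable lebesgue"
    and bound: "\<And>x. norm (\<omega> x) \<le> B" and supp: "\<And>x. x \<notin> {a..b} \<Longrightarrow> \<omega> x = 0"
  shows "\<omega> \<in> orlicz_space \<Phi>"
proof -
  have "modular \<Phi> \<omega> \<le> (\<integral>\<^sup>+x. ennreal (\<Phi> B) * indicator {a..b} x \<partial>lebesgue)"
    unfolding modular_def
  proof (intro nn_integral_mono)
    fix x
    show "ennreal (\<Phi> (norm (\<omega> x))) \<le> ennreal (\<Phi> B) * indicator {a..b} x"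
      using N_function_mono[OF \<Phi>, of "norm (\<omega> x)" B] bound[of x] supp[of x] \<Phi>
      by (auto simp: N_function_def indicator_def intro: ennreal_leI)
  qed
  also have "\<dots> = ennreal (\<Phi> B) * emeasure lebesgue {a..b}"
    by (simp add: nn_integral_cmult_indicator)
  also have "\<dots> < \<infinity>"
    by (simp add: ennreal_mult_less_top emeasure_lborel_Icc_eq)
  finally have "modular \<Phi> (\<lambda>x. 1 *\<^sub>R \<omega> x) < \<infinity>" by simp
  then show ?thesis
    unfolding orlicz_space_def using meas zero_less_one by blast
qed

text \<open>
  Scale \<open>\<beta>\<close> to have finite modular and split it pointwise by \<open>N_function_dominates_linear\<close>: the
  small constant contributes proportionally to \<open>R\<close> with a small factor, while the other part has
  a finite integral over the whole line and is negligible compared with \<open>R\<close>.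
\<close>

lemma orlicz_space_mean_tendsto_zero:
  fixes \<beta> :: "real \<Rightarrow> 'a::real_normed_vector"
  assumes \<Phi>: "N_function \<Phi>" and \<beta>: "\<beta> \<in> orlicz_space \<Phi>" and "0 < \<delta>"
  shows "\<forall>\<^sub>F R in at_top. (\<integral>\<^sup>+x\<in>{-R..R}. ennreal (norm (\<beta> x)) \<partial>lebesgue) \<le> ennreal (\<delta> * R)"
proof -
  obtain \<alpha> where \<alpha>: "\<alpha> > 0" and fin: "modular \<Phi> (\<lambda>x. \<alpha> *\<^sub>R \<beta> x) < \<infinity>"
    and meas [measurable]: "\<beta> \<in> borel_measurable lebesgue"
    using \<beta> by (auto simp: orlicz_space_def)
  obtain M where M: "0 \<le> M" "modular \<Phi> (\<lambda>x. \<alpha> *\<^sub>R \<beta> x) = ennreal M"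
    using fin by (cases "modular \<Phi> (\<lambda>x. \<alpha> *\<^sub>R \<beta> x)") auto
  \<comment> \<open>After division by \<open>\<alpha>\<close>, the constant \<open>\<epsilon>\<close> over an interval of length \<open>2 R\<close> uses up half of \<open>\<delta> R\<close>.\<close>
  define \<epsilon> where "\<epsilon> = \<alpha> * \<delta> / 4"
  define K where "K = \<epsilon> / \<Phi> \<epsilon> / \<alpha>"
  have \<epsilon>: "\<epsilon> > 0" using \<alpha> \<open>0 < \<delta>\<close> by (simp add: \<epsilon>_def)
  have K: "K \<ge> 0" using N_function_pos[OF \<Phi>, of \<epsilon>] \<epsilon> \<alpha> by (simp add: K_def)
  have \<Phi>0: "\<And>x. \<Phi> x \<ge> 0" using \<Phi> by (simp add: N_function_def)
  note [measurable] = N_function_borel_measurable[OF \<Phi>]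
  have pt: "norm (\<beta> x) \<le> \<delta> / 4 + K * \<Phi> (norm (\<alpha> *\<^sub>R \<beta> x))" for x
  proof -
    have "\<alpha> * norm (\<beta> x) \<le> \<epsilon> + \<epsilon> / \<Phi> \<epsilon> * \<Phi> (norm (\<alpha> *\<^sub>R \<beta> x))"
      using N_function_dominates_linear[OF \<Phi> \<epsilon>, of "norm (\<alpha> *\<^sub>R \<beta> x)"] \<alpha> by simp
    then have "norm (\<beta> x) \<le> (\<epsilon> + \<epsilon> / \<Phi> \<epsilon> * \<Phi> (norm (\<alpha> *\<^sub>R \<beta> x))) / \<alpha>"
      using \<alpha> by (simp add: field_simps)
    also have "\<dots> = \<delta> / 4 + K * \<Phi> (norm (\<alpha> *\<^sub>R \<beta> x))"
      using \<alpha> by (simp add: K_def \<epsilon>_def add_divide_distrib)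
    finally show ?thesis .
  qed
  have "(\<integral>\<^sup>+x\<in>{-R..R}. ennreal (norm (\<beta> x)) \<partial>lebesgue) \<le> ennreal (\<delta> * R)"
    if R: "R \<ge> max 0 (2 * K * M / \<delta>)" for R
  proof -
    have "(\<integral>\<^sup>+x\<in>{-R..R}. ennreal (norm (\<beta> x)) \<partial>lebesgue)
        \<le> (\<integral>\<^sup>+x. ennreal (\<delta> / 4) * indicator {-R..R} x
               + ennreal K * ennreal (\<Phi> (norm (\<alpha> *\<^sub>R \<beta> x))) \<partial>lebesgue)"
    proof (intro nn_integral_mono)
      fix x
      show "ennreal (norm (\<beta> x)) * indicator {-R..R} x
          \<le> ennreal (\<delta> / 4) * indicator {-R..R} x
               + ennreal K * ennreal (\<Phi> (norm (\<alpha> *\<^sub>R \<beta> x)))"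
        using ennreal_leI[OF pt[of x]] \<open>0 < \<delta>\<close> K \<Phi>0
        by (auto simp: indicator_def ennreal_plus ennreal_mult simp del: norm_scaleR)
    qed
    also have "\<dots> = ennreal (\<delta> / 4) * emeasure lebesgue {-R..R}
        + ennreal K * modular \<Phi> (\<lambda>x. \<alpha> *\<^sub>R \<beta> x)"
      unfolding modular_def
      by (subst nn_integral_add)
        (auto simp: nn_integral_cmult nn_integral_cmult_indicator measurable_completion)
    also have "\<dots> = ennreal (\<delta> / 4 * (2 * R) + K * M)"
    proof -
      have "R \<ge> 0" using R by simp
      then have "emeasure lebesgue {-R..R} = ennreal (2 * R)"
        by (simp add: emeasure_lborel_Icc_eq)
      moreover have "ennreal (\<delta> / 4 * (2 * R) + K * M) = ennreal (\<delta> / 4 * (2 * R)) + ennreal (K * M)"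
        using \<open>R \<ge> 0\<close> K M \<open>0 < \<delta>\<close> by (intro ennreal_plus) auto
      moreover have "ennreal (\<delta> / 4 * (2 * R)) = ennreal (\<delta> / 4) * ennreal (2 * R)"
        using \<open>R \<ge> 0\<close> \<open>0 < \<delta>\<close> by (intro ennreal_mult) auto
      moreover have "ennreal (K * M) = ennreal K * ennreal M"
        using K M by (intro ennreal_mult)
      ultimately show ?thesis using M by (simp only:)
    qed
    also have "\<dots> \<le> ennreal (\<delta> * R)"
      using R \<open>0 < \<delta>\<close> by (intro ennreal_leI) (simp add: field_simps)
    finally show ?thesis .
  qed
  then show ?thesis
    unfolding eventually_at_top_linorder by blast
qed

section \<open>Smooth cut-off functions\<close>

text \<open>
  Peeling off the first derivative, rather than taking \<open>deriv ^^ k\<close> as in \<open>smooth_function\<close>, lets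
  closure under products and composition follow from the product and chain rules by induction,
  without any Leibniz or Faa di Bruno formula.
\<close>

primrec times_differentiable :: "nat \<Rightarrow> (real \<Rightarrow> real) \<Rightarrow> bool" where
  "times_differentiable 0 f = True"
| "times_differentiable (Suc k) f =
     ((\<forall>x. f differentiable at x) \<and> times_differentiable k (deriv f))"

lemma times_differentiable_SucI:
  assumes "\<And>x. (f has_real_derivative f' x) (at x)" and "times_differentiable k f'"
  shows "times_differentiable (Suc k) f"
proof -
  have "deriv f = f'" using assms(1) by (auto intro: DERIV_imp_deriv)
  then show ?thesis using assms by (auto simp: real_differentiable_def)
qed

lemma times_differentiable_Suc_has_derivative:
  assumes "times_differentiable (Suc k) f"
  shows "(f has_real_derivative deriv f x) (at x)"
  using assms DERIV_deriv_iff_real_differentiable by auto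

lemma times_differentiable_SucD:
  "times_differentiable (Suc k) f \<Longrightarrow> times_differentiable k f"
  by (induction k arbitrary: f) auto

lemma times_differentiable_add:
  assumes "times_differentiable k f" "times_differentiable k g"
  shows "times_differentiable k (\<lambda>x. f x + g x)"
  using assms
proof (induction k arbitrary: f g)
  case (Suc k)
  then show ?case
    by (intro times_differentiable_SucI[where f' = "\<lambda>x. deriv f x + deriv g x"])
      (auto intro!: DERIV_add intro: times_differentiable_Suc_has_derivative)
qed simp

lemma times_differentiable_mult:
  assumes "times_differentiable k f" "times_differentiable k g"
  shows "times_differentiable k (\<lambda>x. f x * g x)"
  using assms
proof (induction k arbitrary: f g)
  case (Suc k)
  have "times_differentiable k (\<lambda>x. deriv f x * g x + deriv g x * f x)"
    using Suc.prems Suc.prems[THEN times_differentiable_SucD]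
    by (intro times_differentiable_add Suc.IH) simp_all
  moreover have "((\<lambda>x. f x * g x) has_real_derivative deriv f x * g x + deriv g x * f x) (at x)" for x
    using Suc.prems by (intro DERIV_mult times_differentiable_Suc_has_derivative)
  ultimately show ?case by (rule times_differentiable_SucI[rotated])
qed simp

lemma times_differentiable_compose:
  assumes "times_differentiable k f" "times_differentiable k g"
  shows "times_differentiable k (\<lambda>x. f (g x))"
  using assms
proof (induction k arbitrary: f)
  case (Suc k)
  have "times_differentiable k (\<lambda>x. deriv f (g x) * deriv g x)"
  proof (rule times_differentiable_mult)
    show "times_differentiable k (\<lambda>x. deriv f (g x))"
      using Suc.prems by (intro Suc.IH[of "deriv f"] times_differentiable_SucD[of k g]) simp_all
    show "times_differentiable k (deriv g)"
      using Suc.prems by simp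
  qed
  moreover have "((\<lambda>x. f (g x)) has_real_derivative deriv f (g x) * deriv g x) (at x)" for x
    using Suc.prems
    by (intro DERIV_chain2[of f _ g] times_differentiable_Suc_has_derivative[of k])
  ultimately show ?case by (rule times_differentiable_SucI[rotated])
qed simp

lemma times_differentiable_poly: "times_differentiable k (poly p)"
proof (induction k arbitrary: p)
  case (Suc k)
  then show ?case by (intro times_differentiable_SucI[OF poly_DERIV])
qed simp

lemma smooth_functionI:
  assumes "\<And>k. times_differentiable k f"
  shows "smooth_function f"
  unfolding smooth_function_def
proof
  fix k
  have "times_differentiable (Suc k) f \<Longrightarrow> (deriv ^^ k) f differentiable_on UNIV"
  proof (induction k arbitrary: f)
    case (Suc k)
    then have "(deriv ^^ k) (deriv f) differentiable_on UNIV" by simp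
    then show ?case by (simp add: funpow_swap1)
  qed (simp add: differentiable_on_def)
  then show "(deriv ^^ k) f differentiable_on UNIV" using assms by blast
qed

text \<open>
  With \<open>p = 1\<close> this is the classical smooth function that is flat at 0.  The polynomial factor in
  \<open>1 / x\<close> makes the family closed under differentiation.
\<close>

definition flat :: "real poly \<Rightarrow> real \<Rightarrow> real" where
  "flat p x = (if x > 0 then poly p (1 / x) * exp (- (1 / x)) else 0)"

lemma poly_times_exp_minus_tendsto_zero:
  "((\<lambda>t::real. poly p t * exp (- t)) \<longlongrightarrow> 0) at_top"
proof -
  have "((\<lambda>t::real. \<Sum>i\<le>degree p. coeff p i * (t ^ i / exp t)) \<longlongrightarrow> (\<Sum>i\<le>degree p. coeff p i * 0)) at_top"
    by (intro tendsto_intros tendsto_power_div_exp_0)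
  then show ?thesis
    by (simp add: poly_altdef sum_distrib_right exp_minus divide_inverse mult.assoc)
qed

text \<open>
  In the variable \<open>t = 1 / x\<close> one has \<open>dt/dx = - t\<^sup>2\<close>, so differentiating \<open>p(t) exp(-t)\<close> turns \<open>p\<close> into
  \<open>t\<^sup>2 (p - p')\<close>.  At 0 the difference quotient from the right is \<open>t p(t) exp(-t)\<close> with
  \<open>t \<rightarrow> \<infinity>\<close>, and the exponential beats the polynomial.
\<close>

lemma flat_has_derivative:
  "(flat p has_real_derivative flat ([:0, 0, 1:] * (p - pderiv p)) x) (at x)"
proof -
  let ?q = "[:0, 0, 1:] * (p - pderiv p)"
  consider "x > 0" | "x < 0" | "x = 0" by linarith
  then show ?thesis
  proof cases
    case 1
    have "((\<lambda>x. poly p (1 / x) * exp (- (1 / x))) has_real_derivative flat ?q x) (at x)"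
      using 1 by (auto intro!: derivative_eq_intros poly_DERIV DERIV_chain2[of "poly p"]
          simp: flat_def power2_eq_square field_simps)
    then show ?thesis
      using 1 by (rule_tac has_field_derivative_transform_within_open[where S = "{0<..}"])
        (auto simp: flat_def)
  next
    case 2
    have "((\<lambda>x. 0) has_real_derivative flat ?q x) (at x)"
      using 2 by (simp add: flat_def)
    then show ?thesis
      using 2 by (rule_tac has_field_derivative_transform_within_open[where S = "{..<0}"])
        (auto simp: flat_def)
  next
    case 3
    have "((\<lambda>y. poly (pCons 0 p) (inverse y) * exp (- inverse y)) \<longlongrightarrow> 0) (at_right (0::real))"
      by (rule filterlim_compose[OF poly_times_exp_minus_tendsto_zero filterlim_inverse_at_top_right])
    then have "((\<lambda>y. (flat p y - flat p 0) / (y - 0)) \<longlongrightarrow> 0) (at_right 0)"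
      by (rule Lim_transform_eventually)
        (auto simp: eventually_at_filter flat_def field_simps)
    moreover have "((\<lambda>y. (flat p y - flat p 0) / (y - 0)) \<longlongrightarrow> 0) (at_left 0)"
      by (rule tendsto_eventually) (auto simp: eventually_at_filter flat_def)
    ultimately show ?thesis
      unfolding 3 has_field_derivative_iff by (simp add: filterlim_split_at flat_def)
  qed
qed

lemma times_differentiable_flat: "times_differentiable k (flat p)"
proof (induction k arbitrary: p)
  case (Suc k)
  then show ?case by (intro times_differentiable_SucI[OF flat_has_derivative])
qed simp

definition cutoff :: "real \<Rightarrow> real \<Rightarrow> real" where
  "cutoff R x = flat 1 (1 - (x / R)\<^sup>2)"

lemma smooth_cutoff: "smooth_function (cutoff R)"
proof (rule smooth_functionI)
  fix k
  have eq: "cutoff R = (\<lambda>x. flat 1 (poly [:1, 0, - 1 / R\<^sup>2:] x))"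
    by (auto simp: cutoff_def fun_eq_iff power2_eq_square)
  show "times_differentiable k (cutoff R)"
    unfolding eq by (rule times_differentiable_compose[OF times_differentiable_flat times_differentiable_poly])
qed

lemma one_le_square_outside:
  fixes R x :: real
  assumes "R > 0" "x \<notin> {-R..R}"
  shows "1 \<le> (x / R)\<^sup>2"
proof -
  have "\<bar>R\<bar> \<le> \<bar>x\<bar>" using assms by auto
  then have "R\<^sup>2 \<le> x\<^sup>2" by (simp only: abs_le_square_iff)
  then show ?thesis using assms(1) by (simp add: power_divide)
qed

lemma cutoff_eq_0:
  assumes "R > 0" "x \<notin> {-R..R}"
  shows "cutoff R x = 0"
  using one_le_square_outside[OF assms] by (simp add: cutoff_def flat_def)

lemma support_cutoff:
  assumes "R > 0"
  shows "compact (support (cutoff R))"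
proof -
  have "{x. cutoff R x \<noteq> 0} \<subseteq> {-R..R}"
    using cutoff_eq_0[OF assms] by blast
  then show ?thesis
    unfolding support_def by (meson bounded_closed_interval bounded_subset compact_closure)
qed

text \<open>
  The scaling estimate behind the choice of test functions.  For \<open>|x| < R\<close> put \<open>t = 1 / (1 - (x/R)\<^sup>2)\<close>.
  The derivative is \<open>t\<^sup>2 exp(-t)\<close> times \<open>- 2 x / R\<^sup>2\<close>; the first factor is at most 2 because
  \<open>exp t \<ge> t\<^sup>2 / 2\<close>, and the second is at most \<open>2 / R\<close> in absolute value.
\<close>

lemma abs_deriv_cutoff_le:
  assumes "R > 0"
  shows "\<bar>deriv (cutoff R) x\<bar> \<le> 4 / R * indicator {-R..R} x"
proof -
  let ?q = "[:0, 0, 1:] :: real poly"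
  let ?y = "1 - (x / R)\<^sup>2"
  have "(cutoff R has_real_derivative flat ?q ?y * (- 2 * x / R\<^sup>2)) (at x)"
  proof -
    have "((\<lambda>x. 1 - (x / R)\<^sup>2) has_real_derivative - 2 * x / R\<^sup>2) (at x)"
      using assms by (auto intro!: derivative_eq_intros simp: power2_eq_square)
    from DERIV_chain2[OF flat_has_derivative[of 1] this] show ?thesis
      by (simp add: cutoff_def[abs_def])
  qed
  then have d: "deriv (cutoff R) x = flat ?q ?y * (- 2 * x / R\<^sup>2)"
    by (rule DERIV_imp_deriv)
  show ?thesis
  proof (cases "x \<in> {-R..R}")
    case True
    have "\<bar>flat ?q ?y\<bar> \<le> 2"
    proof (cases "?y > 0")
      case True
      define t where "t = 1 / ?y"
      have "t > 0" using True by (simp add: t_def)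
      then have "t\<^sup>2 / 2 \<le> exp t" using exp_lower_Taylor_quadratic[of t] by simp
      then have "t\<^sup>2 * exp (- t) \<le> 2" by (simp add: exp_minus field_simps)
      moreover have "flat ?q ?y = t\<^sup>2 * exp (- t)"
        using True by (simp add: flat_def t_def power2_eq_square)
      ultimately show ?thesis by simp
    qed (simp add: flat_def)
    moreover have "\<bar>- 2 * x / R\<^sup>2\<bar> \<le> 2 / R"
      using True assms by (auto simp: abs_mult power2_eq_square field_simps)
    ultimately have "\<bar>flat ?q ?y\<bar> * \<bar>- 2 * x / R\<^sup>2\<bar> \<le> 2 * (2 / R)"
      by (intro mult_mono) auto
    then show ?thesis using True by (simp add: d abs_mult)
  next
    case False
    then have "1 \<le> (x / R)\<^sup>2" by (rule one_le_square_outside[OF assms])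
    then show ?thesis using False by (simp add: d flat_def)
  qed
qed

lemma cutoff_ge:
  assumes "R \<ge> 2" "x \<in> {0..1}"
  shows "exp (- (4 / 3)) \<le> cutoff R x"
proof -
  have "(x / R)\<^sup>2 \<le> (1 / 2)\<^sup>2"
    using assms by (intro power_mono) (auto simp: field_simps)
  then have y: "1 - (x / R)\<^sup>2 \<ge> 3 / 4" by (simp add: power2_eq_square)
  then have "1 / (1 - (x / R)\<^sup>2) \<le> 4 / 3" by (simp add: field_simps)
  then show ?thesis using y by (simp add: cutoff_def flat_def)
qed

section \<open>Weak differentials\<close>

definition density_form :: "(real \<Rightarrow> real) \<Rightarrow> form1" where
  "density_form g = (\<lambda>x. g x *\<^sub>R id_blinfun)"

lemma norm_density_form [simp]: "norm (density_form g x) = \<bar>g x\<bar>"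
  by (simp add: density_form_def)

lemma apply_density_form [simp]: "blinfun_apply (density_form g x) v = g x * v"
  by (simp add: density_form_def scaleR_blinfun.rep_eq)

lemma measurable_density_form:
  assumes "g \<in> borel_measurable M"
  shows "density_form g \<in> borel_measurable M"
proof -
  have "(\<lambda>t. t *\<^sub>R id_blinfun :: real \<Rightarrow>\<^sub>L real) \<in> borel_measurable borel"
    by (intro borel_measurable_continuous_onI continuous_intros)
  then show ?thesis
    unfolding density_form_def by (rule measurable_compose[OF assms])
qed

lemma differential_apply_one:
  assumes "u differentiable at x"
  shows "blinfun_apply (differential u x) 1 = deriv u x"
proof -
  have "(u has_derivative (\<lambda>h. deriv u x * h)) (at x)"
    using assms by (simp add: DERIV_deriv_iff_real_differentiable has_field_derivative_imp_has_derivative)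
  then have "frechet_derivative u (at x) = (\<lambda>h. deriv u x * h)"
    by (metis frechet_derivative_at)
  then show ?thesis
    by (simp add: differential_def bounded_linear_Blinfun_apply bounded_linear_mult_right)
qed

lemma locally_integrableI_bounded:
  fixes \<omega> :: "real \<Rightarrow> 'a::real_normed_vector"
  assumes "\<omega> \<in> borel_measurable lebesgue"
    and "\<And>C. compact C \<Longrightarrow> \<exists>B. \<forall>x\<in>C. norm (\<omega> x) \<le> B"
  shows "locally_integrable \<omega>"
  unfolding locally_integrable_def
proof (intro conjI allI impI)
  fix C :: "real set"
  assume C: "compact C"
  obtain B where B: "\<And>x. x \<in> C \<Longrightarrow> norm (\<omega> x) \<le> B" using assms(2)[OF C] by blast
  have "(\<integral>\<^sup>+x\<in>C. ennreal (norm (\<omega> x)) \<partial>lebesgue) \<le> (\<integral>\<^sup>+x. ennreal B * indicator C x \<partial>lebesgue)"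
    by (intro nn_integral_mono) (auto simp: indicator_def B intro!: ennreal_leI)
  also have "\<dots> = ennreal B * emeasure lebesgue C"
    using C by (intro nn_integral_cmult_indicator) (auto intro: lmeasurable_compact fmeasurableD)
  also have "\<dots> < \<infinity>"
    using emeasure_compact_finite[OF C] C
    by (auto simp: ennreal_mult_less_top borel_compact)
  finally show "(\<integral>\<^sup>+x\<in>C. ennreal (norm (\<omega> x)) \<partial>lebesgue) < \<infinity>" .
qed (fact assms(1))

lemma integrable_lebesgue_bounded_support:
  fixes f :: "real \<Rightarrow> real"
  assumes "f \<in> borel_measurable borel"
    and "\<And>x. \<bar>f x\<bar> \<le> B * indicator {a..b} x"
  shows "integrable lebesgue f"
proof (rule Bochner_Integration.integrable_bound)
  show "integrable lebesgue (\<lambda>x. B * indicator {a..b} x)"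
    by (auto simp: emeasure_lborel_Icc_eq intro!: integrable_mult_right integrable_real_indicator)
  show "f \<in> borel_measurable lebesgue"
    using assms(1) by (simp add: measurable_completion)
  show "AE x in lebesgue. norm (f x) \<le> norm (B * indicator {a..b} x)"
    using assms(2) by (auto intro!: AE_I2 order_trans[OF _ abs_ge_self])
qed

text \<open>
  For a test function \<open>u\<close> with support in \<open>(-R,R)\<close>, the sum \<open>\<beta> u' + g u\<close> is the derivative of the continuous
  function \<open>\<beta> u\<close> outside a finite set.  The fundamental theorem of calculus holds in this generality
  for the Henstock-Kurzweil integral, and gives 0 since \<open>\<beta> u\<close> vanishes at \<open>-R\<close> and \<open>R\<close>; both
  summands are Lebesgue integrable, so the two integrals can be separated.
\<close>

lemma weak_differential_piecewise:
  assumes S: "finite S" and cont: "continuous_on UNIV \<beta>"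
    and deriv: "\<And>x. x \<notin> S \<Longrightarrow> (\<beta> has_real_derivative g x) (at x)"
    and g: "g \<in> borel_measurable borel" and gB: "\<And>x. \<bar>g x\<bar> \<le> B"
  shows "weak_differential \<beta> (density_form g)"
  unfolding weak_differential_def
proof (intro conjI allI impI)
  have \<beta>: "\<beta> \<in> borel_measurable borel"
    using cont by (rule borel_measurable_continuous_onI)
  have bdd: "\<exists>B. \<forall>x\<in>C. norm (h x) \<le> B" if "compact C" "continuous_on UNIV h"
    for C and h :: "real \<Rightarrow> real"
  proof -
    have "bounded (h ` C)"
      using that by (meson compact_continuous_image compact_imp_bounded continuous_on_subset subset_UNIV)
    then show ?thesis by (auto simp: bounded_iff)
  qed
  show "locally_integrable \<beta>"
    using \<beta> bdd[OF _ cont] by (intro locally_integrableI_bounded) (auto simp: measurable_completion)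
  show "locally_integrable (density_form g)"
    using g gB by (intro locally_integrableI_bounded measurable_density_form)
      (auto simp: measurable_completion)
  fix U :: "real set" and u
  assume "open U \<and> connected U \<and> smooth_function u \<and> compact (support u) \<and> support u \<subseteq> U"
  then have sm: "smooth_function u" and cpt: "compact (support u)" and sub: "support u \<subseteq> U"
    by auto
  have diff: "u differentiable at x" "deriv u differentiable at x" for x
    using sm[unfolded smooth_function_def, rule_format, of 0]
      sm[unfolded smooth_function_def, rule_format, of 1]
    by (auto simp: differentiable_on_def)
  have Du: "(u has_real_derivative deriv u x) (at x)" for x
    using diff DERIV_deriv_iff_real_differentiable by blast
  have cont_u: "continuous_on UNIV u" and cont_u': "continuous_on UNIV (deriv u)"
    using diff by (auto intro!: differentiable_imp_continuous_on simp: differentiable_on_def)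
  have u0: "u x = 0" if "x \<notin> support u" for x
    using that closure_subset[of "{x. u x \<noteq> 0}"] by (auto simp: support_def)
  have u'0: "deriv u x = 0" if x: "x \<notin> support u" for x
  proof -
    have "((\<lambda>x. 0) has_real_derivative 0) (at x)" by simp
    then have "(u has_real_derivative 0) (at x)"
    proof (rule has_field_derivative_transform_within_open)
      show "open (- support u)" by (simp add: support_def open_Compl)
    qed (use x u0 in auto)
    then show ?thesis by (rule DERIV_imp_deriv)
  qed
  obtain R where R: "R > 0" "support u \<subseteq> {-R<..<R}"
  proof -
    obtain b where b: "\<And>x. x \<in> support u \<Longrightarrow> \<bar>x\<bar> \<le> b"
      using compact_imp_bounded[OF cpt] by (auto simp: bounded_iff)
    show ?thesis
      by (rule that[of "\<bar>b\<bar> + 1"]) (use b in \<open>force\<close>)+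
  qed
  have out: "u x = 0" "deriv u x = 0" if "x \<notin> {-R..R}" for x
  proof -
    have "x \<notin> support u" using that R by force
    then show "u x = 0" "deriv u x = 0" by (rule u0, rule u'0)
  qed
  let ?f = "\<lambda>x. \<beta> x * deriv u x" and ?h = "\<lambda>x. g x * u x"
  have int_f: "integrable lebesgue ?f"
  proof -
    have c: "continuous_on UNIV ?f" using cont cont_u' by (intro continuous_intros)
    obtain b where b: "\<And>x. x \<in> {-R..R} \<Longrightarrow> \<bar>?f x\<bar> \<le> b"
      using bdd[OF compact_Icc c, of "-R" R] unfolding real_norm_def by blast
    show ?thesis
      using c b out by (intro integrable_lebesgue_bounded_support[of _ b "-R" R])
        (auto intro: borel_measurable_continuous_onI simp: indicator_def)
  qed
  have int_h: "integrable lebesgue ?h"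
  proof -
    obtain b where b: "\<And>x. x \<in> {-R..R} \<Longrightarrow> \<bar>u x\<bar> \<le> b"
      using bdd[OF compact_Icc cont_u, of "-R" R] unfolding real_norm_def by blast
    have "\<bar>?h x\<bar> \<le> B * b * indicator {-R..R} x" for x
    proof (cases "x \<in> {-R..R}")
      case True
      have "0 \<le> B" using gB[of 0] by linarith
      then have "\<bar>g x\<bar> * \<bar>u x\<bar> \<le> B * b" using gB[of x] b[OF True] by (intro mult_mono) auto
      then show ?thesis using True by (simp add: abs_mult)
    qed (simp add: out)
    moreover have "?h \<in> borel_measurable borel"
      using g borel_measurable_continuous_onI[OF cont_u] by measurable
    ultimately show ?thesis by (intro integrable_lebesgue_bounded_support)
  qed
  have "((\<lambda>x. ?f x + ?h x) has_integral (\<beta> R * u R - \<beta> (-R) * u (-R))) {-R..R}"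
  proof (rule fundamental_theorem_of_calculus_interior_strong[OF S])
    show "continuous_on {-R..R} (\<lambda>x. \<beta> x * u x)"
      by (intro continuous_intros continuous_on_subset[OF cont] continuous_on_subset[OF cont_u]) auto
    fix x assume "x \<in> {-R<..<R} - S"
    then have "((\<lambda>x. \<beta> x * u x) has_real_derivative g x * u x + deriv u x * \<beta> x) (at x)"
      by (intro DERIV_mult deriv Du) auto
    then show "((\<lambda>x. \<beta> x * u x) has_vector_derivative ?f x + ?h x) (at x)"
      by (simp add: has_real_derivative_iff_has_vector_derivative algebra_simps)
  qed (use R in auto)
  moreover have "u R = 0" "u (-R) = 0"
    using R by (force intro: u0)+
  ultimately have "((\<lambda>x. ?f x + ?h x) has_integral 0) {-R..R}" by simp
  then have "((\<lambda>x. ?f x + ?h x) has_integral 0) UNIV"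
    by (rule has_integral_on_superset) (auto simp: out)
  then have "integral\<^sup>L lebesgue (\<lambda>x. ?f x + ?h x) = 0"
    using integral_lebesgue[OF Bochner_Integration.integrable_add[OF int_f int_h]]
    by (simp add: integral_unique)
  then have eq: "integral\<^sup>L lebesgue ?f = - integral\<^sup>L lebesgue ?h"
    using int_f int_h by simp
  have "form_integral U (\<lambda>x. \<beta> x *\<^sub>R differential u x) = integral\<^sup>L lebesgue ?f"
    unfolding form_integral_def set_lebesgue_integral_def
    by (intro Bochner_Integration.integral_cong)
      (use sub u'0 in \<open>auto simp: differential_apply_one diff indicator_def scaleR_blinfun.rep_eq\<close>)
  moreover have "form_integral U (\<lambda>x. u x *\<^sub>R density_form g x) = integral\<^sup>L lebesgue ?h"
    unfolding form_integral_def set_lebesgue_integral_def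
    by (intro Bochner_Integration.integral_cong)
      (use sub u0 in \<open>auto simp: indicator_def scaleR_blinfun.rep_eq\<close>)
  ultimately show "form_integral U (\<lambda>x. \<beta> x *\<^sub>R differential u x) =
      - form_integral U (\<lambda>x. u x *\<^sub>R density_form g x)"
    using eq by simp
qed

section \<open>The indicator form of the unit interval\<close>

definition unit_form :: form1 where
  "unit_form = density_form (indicator {0..1})"

lemma zero_exact:
  assumes "N_function \<Phi>1" "N_function \<Phi>2"
  shows "(\<lambda>x. 0) \<in> exact_forms \<Phi>1 \<Phi>2"
proof -
  have "weak_differential (\<lambda>x. 0) (density_form (\<lambda>x. 0))"
    by (rule weak_differential_piecewise[of "{}" _ _ 0]) auto
  then have "weak_differential (\<lambda>x. 0) (\<lambda>x. 0)" by (simp add: density_form_def)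
  moreover have "(\<lambda>x. 0 :: real) \<in> orlicz_space \<Phi>1"
    "(\<lambda>x. 0 :: real \<Rightarrow>\<^sub>L real) \<in> orlicz_space \<Phi>2"
    using assms by (auto intro!: orlicz_space_bounded_support[of _ _ 0])
  ultimately show ?thesis by (auto simp: exact_forms_def)
qed

lemma unit_form_orlicz:
  assumes "N_function \<Phi>"
  shows "unit_form \<in> orlicz_space \<Phi>"
  unfolding unit_form_def
  by (intro orlicz_space_bounded_support[OF assms, of _ 1 0 1] measurable_density_form)
    (auto simp: indicator_def density_form_def measurable_completion)

text \<open>
  The two sides of the weak equation for \<open>u = cutoff R\<close> are incompatible when \<open>R\<close> is large: one has
  absolute value at least \<open>c = exp (- 4/3)\<close> by \<open>cutoff_ge\<close>, the other at most \<open>4 / R\<close> times the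
  integral of \<open>|\<beta>|\<close> over \<open>[-R,R]\<close>, which is eventually at most \<open>c R / 8\<close>.
\<close>

lemma unit_form_not_exact:
  assumes "N_function \<Phi>1"
  shows "unit_form \<notin> exact_forms \<Phi>1 \<Phi>2"
proof
  assume "unit_form \<in> exact_forms \<Phi>1 \<Phi>2"
  then obtain \<beta> where \<beta>: "\<beta> \<in> orlicz_space \<Phi>1" and wd: "weak_differential \<beta> unit_form"
    by (auto simp: exact_forms_def)
  define c :: real where "c = exp (- (4 / 3))"
  have "c > 0" by (simp add: c_def)
  then have "\<forall>\<^sub>F R in at_top. (\<integral>\<^sup>+x\<in>{-R..R}. ennreal (norm (\<beta> x)) \<partial>lebesgue) \<le> ennreal (c / 8 * R)"
    by (intro orlicz_space_mean_tendsto_zero[OF assms \<beta>]) simp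
  then have "\<forall>\<^sub>F R in at_top. R \<ge> 2 \<and>
      (\<integral>\<^sup>+x\<in>{-R..R}. ennreal (norm (\<beta> x)) \<partial>lebesgue) \<le> ennreal (c / 8 * R)"
    by (intro eventually_conj eventually_ge_at_top)
  then obtain R where R: "R \<ge> 2"
    and mean: "(\<integral>\<^sup>+x\<in>{-R..R}. ennreal (norm (\<beta> x)) \<partial>lebesgue) \<le> ennreal (c / 8 * R)"
    by (auto simp: eventually_at_top_linorder)
  let ?u = "cutoff R"
  have diff: "?u differentiable at x" for x
    using smooth_cutoff[of R, unfolded smooth_function_def, rule_format, of 0]
    by (simp add: differentiable_on_def)
  have cont: "continuous_on UNIV ?u"
    using diff by (auto intro!: differentiable_imp_continuous_on simp: differentiable_on_def)
  have [measurable]: "\<beta> \<in> borel_measurable lebesgue"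
    using \<beta> by (simp add: orlicz_space_def)
  have "form_integral UNIV (\<lambda>x. \<beta> x *\<^sub>R differential ?u x) =
      - form_integral UNIV (\<lambda>x. ?u x *\<^sub>R unit_form x)"
    using wd smooth_cutoff support_cutoff R unfolding weak_differential_def by simp
  then have eq: "(LINT x|lebesgue. \<beta> x * deriv ?u x) = - (LINT x|lebesgue. ?u x * indicator {0..1} x)"
    by (simp add: form_integral_def set_lebesgue_integral_def unit_form_def
        differential_apply_one diff scaleR_blinfun.rep_eq)
  have "c = (LINT x|lebesgue. c * indicator {0..1::real} x)"
    by simp
  also have "\<dots> \<le> (LINT x|lebesgue. ?u x * indicator {0..1} x)"
  proof (rule integral_mono)
    show "integrable lebesgue (\<lambda>x. c * indicator {0..1::real} x)"
      by (intro integrable_lebesgue_bounded_support[of _ c 0 1]) (auto simp: indicator_def c_def)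
    have "bounded (?u ` {0..1})"
      using cont by (meson compact_Icc compact_continuous_image compact_imp_bounded continuous_on_subset subset_UNIV)
    then obtain b where b: "\<And>x. x \<in> {0..1} \<Longrightarrow> \<bar>?u x\<bar> \<le> b"
      unfolding bounded_iff real_norm_def by blast
    show "integrable lebesgue (\<lambda>x. ?u x * indicator {0..1} x)"
      using b borel_measurable_continuous_onI[OF cont]
      by (intro integrable_lebesgue_bounded_support[of _ b 0 1]) (auto simp: indicator_def)
    show "c * indicator {0..1} x \<le> ?u x * indicator {0..1} x" for x
      using cutoff_ge[OF R, of x] by (auto simp: indicator_def c_def)
  qed
  finally have lower: "c \<le> \<bar>LINT x|lebesgue. \<beta> x * deriv ?u x\<bar>"
    using eq by simp
  have "ennreal \<bar>LINT x|lebesgue. \<beta> x * deriv ?u x\<bar> \<le> (\<integral>\<^sup>+x. ennreal (norm (\<beta> x * deriv ?u x)) \<partial>lebesgue)"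
  proof (cases "integrable lebesgue (\<lambda>x. \<beta> x * deriv ?u x)")
    case True
    from integral_norm_bound_ennreal[OF this] show ?thesis unfolding real_norm_def .
  next
    case False
    then show ?thesis by (simp add: not_integrable_integral_eq)
  qed
  also have "\<dots> \<le> (\<integral>\<^sup>+x. ennreal (4 / R) * (ennreal (norm (\<beta> x)) * indicator {-R..R} x) \<partial>lebesgue)"
  proof (intro nn_integral_mono)
    fix x
    have "norm (\<beta> x * deriv ?u x) \<le> \<bar>\<beta> x\<bar> * (4 / R * indicator {-R..R} x)"
      unfolding real_norm_def abs_mult using R
      by (intro mult_left_mono abs_deriv_cutoff_le) auto
    also have "\<dots> = 4 / R * \<bar>\<beta> x\<bar> * indicator {-R..R} x" by simp
    finally show "ennreal (norm (\<beta> x * deriv ?u x))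
        \<le> ennreal (4 / R) * (ennreal (norm (\<beta> x)) * indicator {-R..R} x)"
      using R by (auto simp: indicator_def ennreal_mult[symmetric] intro!: ennreal_leI split: if_splits)
  qed
  also have "\<dots> = ennreal (4 / R) * (\<integral>\<^sup>+x\<in>{-R..R}. ennreal (norm (\<beta> x)) \<partial>lebesgue)"
    by (intro nn_integral_cmult borel_measurable_times_ennreal borel_measurable_indicator) auto
  also have "\<dots> \<le> ennreal (4 / R) * ennreal (c / 8 * R)"
    by (intro mult_left_mono mean) simp
  also have "\<dots> = ennreal (c / 2)"
    using R \<open>c > 0\<close> by (simp add: ennreal_mult[symmetric])
  finally show False
    using lower \<open>c > 0\<close> by (simp add: ennreal_le_iff)
qed

text \<open>
  The derivative of the tent that rises with slope 1 on \<open>[0,1]\<close> and descends to 0 over a length \<open>L\<close>.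
\<close>

definition tent_slope :: "real \<Rightarrow> real \<Rightarrow> real" where
  "tent_slope L x = indicator {0..1} x - 1 / L * indicator {1<..1 + L} x"

lemma tent_slope_exact:
  assumes \<Phi>: "N_function \<Phi>1" "N_function \<Phi>2" and L: "L > 0"
  shows "density_form (tent_slope L) \<in> exact_forms \<Phi>1 \<Phi>2"
proof -
  let ?\<beta> = "\<lambda>x. max 0 (min x (1 + (1 - x) / L))"
  have meas: "tent_slope L \<in> borel_measurable borel"
    unfolding tent_slope_def by measurable
  have bound: "\<bar>tent_slope L x\<bar> \<le> 1 + 1 / L" for x
    using L by (auto simp: tent_slope_def indicator_def)
  have cont: "continuous_on UNIV ?\<beta>"
    using L by (intro continuous_intros) auto
  have "weak_differential ?\<beta> (density_form (tent_slope L))"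
  proof (rule weak_differential_piecewise[OF _ cont _ meas bound])
    show "finite {0, 1, 1 + L}" by simp
    fix x assume "x \<notin> {0, 1, 1 + L}"
    then consider "x < 0" | "0 < x" "x < 1" | "1 < x" "x < 1 + L" | "1 + L < x"
      using L by fastforce
    then show "(?\<beta> has_real_derivative tent_slope L x) (at x)"
    proof cases
      case 1
      have "((\<lambda>x. 0) has_real_derivative tent_slope L x) (at x)"
        using 1 by (simp add: tent_slope_def)
      then show ?thesis
        by (rule has_field_derivative_transform_within_open[where S = "{..<0}"])
          (use 1 in auto)
    next
      case 2
      have "((\<lambda>x. x) has_real_derivative tent_slope L x) (at x)"
        using 2 by (simp add: tent_slope_def)
      then show ?thesis
      proof (rule has_field_derivative_transform_within_open[where S = "{0<..<1}"])
        fix y :: real assume y: "y \<in> {0<..<1}"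
        then have "0 \<le> (1 - y) / L" using L by simp
        then show "y = ?\<beta> y" using y by (simp add: min_def)
      qed (use 2 in auto)
    next
      case 3
      have "((\<lambda>x. 1 + (1 - x) / L) has_real_derivative tent_slope L x) (at x)"
        using 3 L by (auto intro!: derivative_eq_intros simp: tent_slope_def)
      then show ?thesis
      proof (rule has_field_derivative_transform_within_open[where S = "{1<..<1 + L}"])
        fix y assume y: "y \<in> {1<..<1 + L}"
        then have "(1 - y) / L \<le> 0" "-1 \<le> (1 - y) / L"
          using L by (auto simp: field_simps)
        then show "1 + (1 - y) / L = ?\<beta> y" using y by (simp add: min_def)
      qed (use 3 in auto)
    next
      case 4
      have "((\<lambda>x. 0) has_real_derivative tent_slope L x) (at x)"
        using 4 L by (simp add: tent_slope_def)
      then show ?thesis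
      proof (rule has_field_derivative_transform_within_open[where S = "{1 + L<..}"])
        fix y assume "y \<in> {1 + L<..}"
        then have "1 + (1 - y) / L \<le> 0" using L by (simp add: field_simps)
        then show "0 = ?\<beta> y" by (simp add: max_def min_def)
      qed (use 4 in auto)
    qed
  qed
  moreover have "?\<beta> \<in> orlicz_space \<Phi>1"
  proof (rule orlicz_space_bounded_support[OF \<Phi>(1)])
    show "?\<beta> \<in> borel_measurable lebesgue"
      using borel_measurable_continuous_onI[OF cont] by (simp add: measurable_completion)
    show "norm (?\<beta> x) \<le> 1 + L" for x
    proof (cases "x \<le> 1")
      case False
      then have "(1 - x) / L \<le> 0" using L by (auto simp: field_simps)
      then show ?thesis using L by auto
    qed (use L in auto)
    show "?\<beta> x = 0" if x: "x \<notin> {0..1 + L}" for x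
    proof (cases "x < 0")
      case False
      then have "1 + (1 - x) / L \<le> 0" using x L by (simp add: field_simps)
      then show ?thesis by (simp add: max_def min_def)
    qed simp
  qed
  moreover have "density_form (tent_slope L) \<in> orlicz_space \<Phi>2"
    using meas bound L
    by (intro orlicz_space_bounded_support[OF \<Phi>(2), of _ "1 + 1 / L" 0 "1 + L"] measurable_density_form)
      (auto simp: measurable_completion density_form_def tent_slope_def indicator_def)
  ultimately show ?thesis by (auto simp: exact_forms_def)
qed

text \<open>
  The remainder \<open>\<omega> - \<eta>\<^sub>L\<close> is the constant \<open>1/L\<close> spread over an interval of length \<open>L\<close>.  After division by
  \<open>K\<close> its value is \<open>y = 1/(L K)\<close>, and its modular is \<open>L \<Phi>2 y = \<Phi>2 y / (K y)\<close>, which is at most 1 as soon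
  as \<open>y\<close> is small.  Choosing \<open>y\<close> first and solving for \<open>L\<close> avoids any limit in \<open>L\<close>.
\<close>

lemma unit_form_in_closure:
  assumes \<Phi>: "N_function \<Phi>1" "N_function \<Phi>2"
  shows "unit_form \<in> closure_exact_forms \<Phi>1 \<Phi>2"
  unfolding closure_exact_forms_def
proof (intro CollectI conjI allI impI unit_form_orlicz \<Phi>(2))
  fix \<epsilon> :: real assume "\<epsilon> > 0"
  define K where "K = \<epsilon> / 2"
  have K: "K > 0" using \<open>\<epsilon> > 0\<close> by (simp add: K_def)
  have "((\<lambda>x. \<Phi>2 x / x) \<longlongrightarrow> 0) (at 0)" using \<Phi>(2) by (simp add: N_function_def)
  then obtain d where d: "d > 0" "\<And>x. x \<noteq> 0 \<Longrightarrow> \<bar>x\<bar> < d \<Longrightarrow> \<bar>\<Phi>2 x / x\<bar> < K"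
    using K unfolding LIM_def by (auto simp: dist_real_def)
  define y where "y = d / 2"
  define L where "L = 1 / (y * K)"
  have y: "y > 0" "\<Phi>2 y < K * y"
    using d(1) d(2)[of y] by (auto simp: y_def field_simps)
  have L: "L > 0" using y K by (simp add: L_def)
  have diff: "(\<lambda>x. unit_form x - density_form (tent_slope L) x)
      = density_form (\<lambda>x. 1 / L * indicator {1<..1 + L} x)"
    by (simp add: fun_eq_iff unit_form_def density_form_def tent_slope_def scaleR_diff_left[symmetric])
  \<comment> \<open>\<open>L\<close> is chosen so that the remainder divided by \<open>K\<close> takes the value \<open>y\<close> on its support.\<close>
  have "modular \<Phi>2 (\<lambda>x. density_form (\<lambda>x. 1 / L * indicator {1<..1 + L} x) x /\<^sub>R K)
      = (\<integral>\<^sup>+x. ennreal (\<Phi>2 y) * indicator {1<..1 + L} x \<partial>lebesgue)"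
    unfolding modular_def
  proof (intro nn_integral_cong)
    fix x
    have "\<Phi>2 0 = 0" using \<Phi>(2) by (simp add: N_function_def)
    moreover have "inverse K * (1 / L) = y" using y K by (simp add: L_def field_simps)
    ultimately show "ennreal (\<Phi>2 (norm (density_form (\<lambda>x. 1 / L * indicator {1<..1 + L} x) x /\<^sub>R K)))
        = ennreal (\<Phi>2 y) * indicator {1<..1 + L} x"
      using K L by (auto simp: indicator_def)
  qed
  also have "\<dots> = ennreal (\<Phi>2 y * L)"
    using L \<Phi>(2) by (simp add: nn_integral_cmult_indicator ennreal_mult N_function_def)
  also have "\<dots> \<le> 1"
    using y K by (simp add: L_def field_simps)
  finally have "gauge_norm \<Phi>2 (\<lambda>x. unit_form x - density_form (tent_slope L) x) \<le> K"
    unfolding gauge_norm_def diff using K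
    by (intro cInf_lower) (auto intro!: bdd_belowI[of _ 0])
  also have "K < \<epsilon>" using \<open>\<epsilon> > 0\<close> by (simp add: K_def)
  finally show "\<exists>\<eta>\<in>exact_forms \<Phi>1 \<Phi>2. gauge_norm \<Phi>2 (\<lambda>x. unit_form x - \<eta> x) < \<epsilon>"
    using tent_slope_exact[OF \<Phi> L] by blast
qed

theorem proposition4p1:
  fixes \<Phi>1 \<Phi>2 :: "real \<Rightarrow> real"
  assumes "N_function \<Phi>1" and "N_function \<Phi>2"
  shows "torsion \<Phi>1 \<Phi>2 \<noteq> {exact_forms \<Phi>1 \<Phi>2}"
proof
  \<comment> \<open>If every coset were the space of exact forms, this would hold for the coset of \<open>unit_form\<close>, which
    contains \<open>unit_form\<close> itself because 0 is exact.\<close>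
  let ?C = "closure_exact_forms \<Phi>1 \<Phi>2" and ?B = "exact_forms \<Phi>1 \<Phi>2"
  let ?r = "{(\<omega>, \<omega>'). \<omega> \<in> ?C \<and> \<omega>' \<in> ?C \<and> (\<lambda>x. \<omega> x - \<omega>' x) \<in> ?B}"
  assume "torsion \<Phi>1 \<Phi>2 = {?B}"
  moreover have "?r `` {unit_form} \<in> torsion \<Phi>1 \<Phi>2"
    unfolding torsion_def using unit_form_in_closure[OF assms] by (rule quotientI)
  ultimately have "?r `` {unit_form} = ?B" by simp
  moreover have "unit_form \<in> ?r `` {unit_form}"
    using unit_form_in_closure[OF assms] zero_exact[OF assms] by simp
  ultimately show False using unit_form_not_exact[OF assms(1)] by blast
qed

end
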